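(* Let $(X,d,\mathfrak{m})$ be a complete, separable metric measure space with $\int_Xe^{-cd(x,y)^2}\,\mathfrak{m}(dy)<\infty$ for some (hence all) $x\in X$ and all $c>0$, and suppose that it satisfies $\mathrm{CD}^e(K,N)$ for some $K\in\mathbb{R}$ and $N<0$. Then, for any $\mu_0,\mu_1\in\mathcal{P}^2(X)$ with $\mathrm{Ent}_{\mathfrak{m}}(\mu_0)<\infty$ and with $W_2(\mu_0,\mu_1)\le\pi\sqrt{N/K}$ if $K<0$, we have $$\frac{E_N(\mu_1)}{E_N(\mu_0)}\ge\mathfrak{c}_{K/N}\big(W_2(\mu_0,\mu_1)\big)+\frac{\mathfrak{s}_{K/N}(W_2(\mu_0,\mu_1))}{N}\sqrt{I_{\mathfrak{m}}(\mu_0)}.$$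
   Context: For $\kappa\in\mathbb{R}$ and $\theta\ge0$: $\mathfrak{s}_\kappa(\theta)=\frac{1}{\sqrt{\kappa}}\sin(\sqrt{\kappa}\theta)$, $\mathfrak{c}_\kappa(\theta)=\cos(\sqrt{\kappa}\theta)$ if $\kappa>0$; $\mathfrak{s}_0(\theta)=\theta$, $\mathfrak{c}_0(\theta)=1$; $\mathfrak{s}_\kappa(\theta)=\frac{1}{\sqrt{-\kappa}}\sinh(\sqrt{-\kappa}\theta)$, $\mathfrak{c}_\kappa(\theta)=\cosh(\sqrt{-\kappa}\theta)$ if $\kappa<0$. For $t\in[0,1]$, $\sigma^{(t)}_\kappa(\theta)=\mathfrak{s}_\kappa(t\theta)/\mathfrak{s}_\kappa(\theta)$ (with $\theta>0$ if $\kappa\le0$, $\theta\in(0,\pi/\sqrt{\kappa})$ if $\kappa>0$), and $\sigma^{(t)}_\kappa(0)=t$. $\mathcal{P}^2(X)$ is the set of Borel probability measures on $X$ with finite second moment, equipped with the $L^2$-Wasserstein distance $W_2$. The relative entropy is $\mathrm{Ent}_{\mathfrak{m}}(\mu)=\int_X\rho\log\rho\,d\mathfrak{m}$ if $\mu=\rho\mathfrak{m}\ll\mathfrak{m}$ and $\int_{\{\rho>1\}}\rho\log\rho\,d\mathfrak{m}<\infty$, and $\mathrm{Ent}_{\mathfrak{m}}(\mu)=\infty$ otherwise. Put $E_N(\mu)=\exp(-\mathrm{Ent}_{\mathfrak{m}}(\mu)/N)$ (so $E_N(\mu)=\infty$ if $\mathrm{Ent}_{\mathfrak{m}}(\mu)=\infty$).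 $(K,N)$-convexity ($N<0$): on a metric space $(Y,\delta)$, a function $f:Y\to(-\infty,\infty]$ with $f_N:=e^{-f/N}$ is $(K,N)$-convex if any $y_0,y_1$ with $f(y_0),f(y_1)<\infty$, and with $D:=\delta(y_0,y_1)<\pi\sqrt{N/K}$ when $K<0$, admit a minimal geodesic $\gamma:[0,1]\to Y$ (i.e. $\delta(\gamma(s),\gamma(t))=|s-t|\delta(\gamma(0),\gamma(1))$) from $y_0$ to $y_1$ with $f_N(\gamma(t))\le\sigma^{(1-t)}_{K/N}(D)f_N(y_0)+\sigma^{(t)}_{K/N}(D)f_N(y_1)$ for all $t\in[0,1]$. The space $(X,d,\mathfrak{m})$ satisfies $\mathrm{CD}^e(K,N)$ if $\mathrm{Ent}_{\mathfrak{m}}$ is $(K,N)$-convex on $(\mathcal{P}^2(X),W_2)$. The Fisher information of $\mu$ with $\mathrm{Ent}_{\mathfrak{m}}(\mu)<\infty$ is $I_{\mathfrak{m}}(\mu)=|\nabla_-\mathrm{Ent}_{\mathfrak{m}}|(\mu)^2\in[0,\infty]$, where $|\nabla_-\mathrm{Ent}_{\mathfrak{m}}|(\mu)=\max\{\limsup_{\nu\to\mu}\frac{\mathrm{Ent}_{\mathfrak{m}}(\mu)-\mathrm{Ent}_{\mathfrak{m}}(\nu)}{W_2(\mu,\nu)},0\}$ (limit in $(\mathcal{P}^2(X),W_2)$). The convention $0\cdot\infty=0$ is used; if $I_{\mathfrak{m}}(\mu_0)=\infty$ and $\mathfrak{s}_{K/N}(W_2(\mu_0,\mu_1))>0$ the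 right-hand side is $-\infty$. *)

theory Defs
  imports "HOL-Probability.Probability"
begin

section \<open>Comparison functions\<close>

definition s_fun :: "real \<Rightarrow> real \<Rightarrow> real" where
  "s_fun \<kappa> \<theta> =
    (if \<kappa> > 0 then sin (sqrt \<kappa> * \<theta>) / sqrt \<kappa>
     else if \<kappa> = 0 then \<theta>
     else sinh (sqrt (- \<kappa>) * \<theta>) / sqrt (- \<kappa>))"

definition c_fun :: "real \<Rightarrow> real \<Rightarrow> real" where
  "c_fun \<kappa> \<theta> =
    (if \<kappa> > 0 then cos (sqrt \<kappa> * \<theta>)
     else if \<kappa> = 0 then 1
     else cosh (sqrt (- \<kappa>) * \<theta>))"

definition \<sigma>_coeff :: "real \<Rightarrow> real \<Rightarrow> real \<Rightarrow> real" where
  "\<sigma>_coeff \<kappa> t \<theta> = (if \<theta> = 0 then t else s_fun \<kappa> (t * \<theta>) / s_fun \<kappa> \<theta>)"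


section \<open>Convexity and slopes of extended-real functions\<close>

text \<open>A metric space is given here by a carrier set \<open>Y\<close> and a distance \<open>\<delta>\<close>. The map
  \<open>expN N\<close> is \<open>a \<mapsto> exp (- a / N)\<close>, extended to infinite arguments by continuity for
  \<open>N < 0\<close>, the only case of interest.\<close>

definition expN :: "real \<Rightarrow> ereal \<Rightarrow> ereal" where
  "expN N a = (case a of ereal r \<Rightarrow> ereal (exp (- r / N)) | PInfty \<Rightarrow> \<infinity> | MInfty \<Rightarrow> 0)"

definition minimal_geodesic ::
  "'y set \<Rightarrow> ('y \<Rightarrow> 'y \<Rightarrow> real) \<Rightarrow> 'y \<Rightarrow> 'y \<Rightarrow> (real \<Rightarrow> 'y) \<Rightarrow> bool" where
  "minimal_geodesic Y \<delta> y0 y1 \<gamma> \<longleftrightarrow>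
     (\<forall>t\<in>{0..1}. \<gamma> t \<in> Y) \<and> \<gamma> 0 = y0 \<and> \<gamma> 1 = y1 \<and>
     (\<forall>s\<in>{0..1}. \<forall>t\<in>{0..1}. \<delta> (\<gamma> s) (\<gamma> t) = \<bar>s - t\<bar> * \<delta> (\<gamma> 0) (\<gamma> 1))"

definition KN_convex ::
  "real \<Rightarrow> real \<Rightarrow> 'y set \<Rightarrow> ('y \<Rightarrow> 'y \<Rightarrow> real) \<Rightarrow> ('y \<Rightarrow> ereal) \<Rightarrow> bool" where
  "KN_convex K N Y \<delta> f \<longleftrightarrow>
     (\<forall>y0\<in>Y. \<forall>y1\<in>Y. f y0 < \<infinity> \<longrightarrow> f y1 < \<infinity> \<longrightarrow>
        (K < 0 \<longrightarrow> \<delta> y0 y1 < pi * sqrt (N / K)) \<longrightarrow>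
        (\<exists>\<gamma>. minimal_geodesic Y \<delta> y0 y1 \<gamma> \<and>
             (\<forall>t\<in>{0..1}. expN N (f (\<gamma> t))
                \<le> ereal (\<sigma>_coeff (K / N) (1 - t) (\<delta> y0 y1)) * expN N (f y0)
                 + ereal (\<sigma>_coeff (K / N) t (\<delta> y0 y1)) * expN N (f y1))))"

definition punctured_nhds :: "'y set \<Rightarrow> ('y \<Rightarrow> 'y \<Rightarrow> real) \<Rightarrow> 'y \<Rightarrow> 'y filter" where
  "punctured_nhds Y \<delta> y = (INF r\<in>{0<..}. principal {z \<in> Y. z \<noteq> y \<and> \<delta> y z < r})"

text \<open>The limsup over the trivial filter is \<open>-\<infinity>\<close>, so the slope at an isolated point is 0.\<close>

definition descending_slope ::
  "'y set \<Rightarrow> ('y \<Rightarrow> 'y \<Rightarrow> real) \<Rightarrow> ('y \<Rightarrow> ereal) \<Rightarrow> 'y \<Rightarrow> ereal" where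
  "descending_slope Y \<delta> f y =
     max (Limsup (punctured_nhds Y \<delta> y) (\<lambda>z. (f y - f z) / ereal (\<delta> y z))) 0"

definition sqrt_ereal :: "ereal \<Rightarrow> ereal" where
  "sqrt_ereal a = (case a of ereal r \<Rightarrow> ereal (sqrt r) | PInfty \<Rightarrow> \<infinity> | MInfty \<Rightarrow> 0)"


section \<open>Wasserstein space\<close>

definition P2 :: "'a::{complete_space, second_countable_topology} measure set" where
  "P2 = {\<mu>. prob_space \<mu> \<and> sets \<mu> = sets borel \<and>
            (\<exists>x. (\<integral>\<^sup>+ y. ennreal ((dist x y)\<^sup>2) \<partial>\<mu>) < \<infinity>)}"

definition couplings ::
  "'a::{complete_space, second_countable_topology} measure \<Rightarrow> 'a measure \<Rightarrow> ('a \<times> 'a) measure set" where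
  "couplings \<mu> \<nu> = {\<pi>. sets \<pi> = sets (borel \<Otimes>\<^sub>M borel) \<and>
                       distr \<pi> borel fst = \<mu> \<and> distr \<pi> borel snd = \<nu>}"

text \<open>The infimum is finite on \<open>P2\<close>, so the conversion to a real number loses nothing there.\<close>

definition W2 ::
  "'a::{complete_space, second_countable_topology} measure \<Rightarrow> 'a measure \<Rightarrow> real" where
  "W2 \<mu> \<nu> = sqrt (enn2real (\<Sqinter>\<pi>\<in>couplings \<mu> \<nu>. \<integral>\<^sup>+ p. ennreal ((dist (fst p) (snd p))\<^sup>2) \<partial>\<pi>))"


section \<open>Relative entropy, the curvature-dimension condition and Fisher information\<close>

text \<open>The first conjunct says that \<open>\<mu>\<close> has a density \<open>\<rho>\<close> with respect to \<open>m\<close>. The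
  integral of \<open>\<rho> log \<rho>\<close> is the extended-real one, i.e. the difference of the integrals of its
  positive and negative parts (\<open>ennreal\<close> truncates negative numbers to 0); the second
  conjunct makes the former finite. At points where \<open>\<rho> = 0\<close> the integrand is \<open>0 * ln 0 = 0\<close>.\<close>

definition Ent :: "'a measure \<Rightarrow> 'a measure \<Rightarrow> ereal" where
  "Ent m \<mu> =
     (let \<rho> = (\<lambda>x. enn2real (RN_deriv m \<mu> x)) in
      if density m (RN_deriv m \<mu>) = \<mu> \<and>
         (\<integral>\<^sup>+ x\<in>{x. \<rho> x > 1}. ennreal (\<rho> x * ln (\<rho> x)) \<partial>m) < \<infinity>
      then enn2ereal (\<integral>\<^sup>+ x. ennreal (\<rho> x * ln (\<rho> x)) \<partial>m)
           - enn2ereal (\<integral>\<^sup>+ x. ennreal (- (\<rho> x * ln (\<rho> x))) \<partial>m)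
      else \<infinity>)"

definition E_N :: "real \<Rightarrow> 'a measure \<Rightarrow> 'a measure \<Rightarrow> ereal" where
  "E_N N m \<mu> = expN N (Ent m \<mu>)"

definition CDe ::
  "real \<Rightarrow> real \<Rightarrow> 'a::{complete_space, second_countable_topology} measure \<Rightarrow> bool" where
  "CDe K N m \<longleftrightarrow> KN_convex K N P2 W2 (Ent m)"

definition Fisher_information ::
  "'a::{complete_space, second_countable_topology} measure \<Rightarrow> 'a measure \<Rightarrow> ereal" where
  "Fisher_information m \<mu> = (descending_slope P2 W2 (Ent m) \<mu>)\<^sup>2"

end

theory Submission
  imports Defs
begin

text \<open>
  The inequality is what convexity along a single geodesic says to first order at its starting point. Let \<open>D = W2 \<mu>0 \<mu>1\<close> and
  \<open>\<kappa> = K / N\<close>. Along the geodesic \<open>\<gamma>\<close> that \<open>CDe K N\<close> provides, at arc length \<open>h = t D\<close>,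
  convexity can be solved for the endpoint:
  \<open>E_N(\<mu>1) / E_N(\<mu>0) \<ge> (s_fun \<kappa> D * E_N(\<gamma> t) / E_N(\<mu>0) - s_fun \<kappa> (D - h)) / s_fun \<kappa> h\<close>.
  Since \<open>exp\<close> lies above its tangent line,
  \<open>E_N(\<gamma> t) / E_N(\<mu>0) \<ge> 1 + (Ent \<mu>0 - Ent (\<gamma> t)) / N\<close>. The constant \<open>1\<close> contributes
  \<open>(s_fun \<kappa> D - s_fun \<kappa> (D - h)) / s_fun \<kappa> h\<close>, which tends to \<open>c_fun \<kappa> D\<close> as \<open>h\<close> tends
  to \<open>0\<close>. The entropy difference, divided by \<open>s_fun \<kappa> h \<sim> h\<close>, is in the limit at most the
  descending slope at \<open>\<mu>0\<close>, the square root of the Fisher information; because \<open>N < 0\<close>, this upper bound on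
  the difference becomes the required lower bound. The argument works for every \<open>(K, N)\<close>-convex function
  that avoids \<open>-\<infinity>\<close>, and \<open>KN_convex_slope_inequality\<close> states it in that generality.

  Two facts about measures are needed to apply it. The entropy avoids \<open>-\<infinity>\<close> on \<open>P2\<close>
  (\<open>Ent_not_MInf\<close>): against a Gaussian weight with finite mass, the negative part of \<open>\<rho> log \<rho>\<close> is
  controlled by the second moment. And \<open>W2 \<mu> \<nu> = 0\<close> forces \<open>\<mu> = \<nu>\<close> (\<open>W2_eq_0_imp_eq\<close>), which
  settles the case \<open>D = 0\<close>: couplings of arbitrarily small cost show that no closed set has larger
  \<open>\<mu>\<close>-mass than the \<open>\<nu>\<close>-mass of its thickenings.
\<close>

section \<open>Comparison functions\<close>

lemma s_fun_0 [simp]: "s_fun \<kappa> 0 = 0"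
  by (simp add: s_fun_def)

lemma c_fun_0 [simp]: "c_fun \<kappa> 0 = 1"
  by (simp add: c_fun_def)

lemma DERIV_s_fun: "(s_fun \<kappa> has_real_derivative c_fun \<kappa> \<theta>) (at \<theta>)"
proof -
  consider "\<kappa> > 0" | "\<kappa> = 0" | "\<kappa> < 0" by linarith
  then show ?thesis
  proof cases
    case 1
    then have "s_fun \<kappa> = (\<lambda>\<theta>. sin (sqrt \<kappa> * \<theta>) / sqrt \<kappa>)" "c_fun \<kappa> \<theta> = cos (sqrt \<kappa> * \<theta>)"
      by (auto simp: s_fun_def c_fun_def)
    with 1 show ?thesis by (auto intro!: derivative_eq_intros simp: mult.assoc)
  next
    case 2
    then have "s_fun \<kappa> = (\<lambda>\<theta>. \<theta>)" "c_fun \<kappa> \<theta> = 1"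
      by (auto simp: s_fun_def c_fun_def)
    then show ?thesis by simp
  next
    case 3
    then have "s_fun \<kappa> = (\<lambda>\<theta>. sinh (sqrt (-\<kappa>) * \<theta>) / sqrt (-\<kappa>))"
      "c_fun \<kappa> \<theta> = cosh (sqrt (-\<kappa>) * \<theta>)"
      by (auto simp: s_fun_def c_fun_def)
    with 3 show ?thesis by (auto intro!: derivative_eq_intros simp: mult.assoc)
  qed
qed

text \<open>For \<open>K < 0\<close> the number \<open>\<pi> \<surd>(N / K)\<close> is the first positive zero of
  \<open>s_fun (K / N)\<close>. Below this critical distance \<open>s_fun\<close> is positive, so that a convexity inequality can
  be multiplied and divided by its values.\<close>

lemma sqrt_mult_critical_distance:
  assumes "K < 0" "N < 0"
  shows "sqrt (K / N) * (pi * sqrt (N / K)) = pi"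
  using assms by (simp add: real_sqrt_divide)

lemma s_fun_pos:
  assumes "0 < \<theta>" "\<kappa> > 0 \<Longrightarrow> sqrt \<kappa> * \<theta> < pi"
  shows "0 < s_fun \<kappa> \<theta>"
  using assms by (auto simp: s_fun_def intro!: divide_pos_pos sin_gt_zero)

lemma s_fun_pos_below_critical_distance:
  assumes N: "N < 0" and \<theta>: "0 < \<theta>" "K < 0 \<Longrightarrow> \<theta> < pi * sqrt (N / K)"
  shows "0 < s_fun (K / N) \<theta>"
proof (rule s_fun_pos[OF \<theta>(1)])
  assume \<kappa>: "K / N > 0"
  then have K: "K < 0" using N by (auto simp: zero_less_divide_iff)
  have "sqrt (K / N) * \<theta> < sqrt (K / N) * (pi * sqrt (N / K))"
    using \<theta>(2)[OF K] \<kappa> by (intro mult_strict_left_mono) auto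
  then show "sqrt (K / N) * \<theta> < pi"
    by (simp only: sqrt_mult_critical_distance[OF K N])
qed

lemma comparison_functions_at_critical_distance:
  assumes "K < 0" "N < 0"
  shows "c_fun (K / N) (pi * sqrt (N / K)) = -1" "s_fun (K / N) (pi * sqrt (N / K)) = 0"
  using assms by (simp_all only: c_fun_def s_fun_def sqrt_mult_critical_distance divide_neg_neg
      if_True cos_pi sin_pi div_0)

lemma s_fun_tendsto_at_right_0: "((\<lambda>h. s_fun \<kappa> h / h) \<longlongrightarrow> 1) (at_right 0)"
  using DERIV_s_fun[of \<kappa> 0]
  by (auto simp: DERIV_def intro: tendsto_mono[OF at_le])

text \<open>Both numerator and denominator vanish at \<open>h = 0\<close>, with derivatives \<open>c_fun \<kappa> D\<close> and
  \<open>c_fun \<kappa> 0 = 1\<close>. This is how the cosine term arises when a convexity inequality along a geodesic of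
  length \<open>D\<close> is divided by the weight of its endpoint and the starting point is approached.\<close>

lemma s_fun_difference_quotient_tendsto:
  "((\<lambda>h. (s_fun \<kappa> D - s_fun \<kappa> (D - h)) / s_fun \<kappa> h) \<longlongrightarrow> c_fun \<kappa> D) (at_right 0)"
proof -
  have "((\<lambda>h. s_fun \<kappa> (D - h)) has_real_derivative (- c_fun \<kappa> D)) (at 0)"
  proof -
    have "((\<lambda>h. D - h) has_real_derivative - 1) (at 0)"
      by (auto intro!: derivative_eq_intros)
    then have "((\<lambda>h. s_fun \<kappa> (D - h)) has_real_derivative c_fun \<kappa> (D - 0) * - 1) (at 0)"
      by (rule DERIV_chain2[OF DERIV_s_fun])
    then show ?thesis by simp
  qed
  then have "((\<lambda>h. - ((s_fun \<kappa> (D - h) - s_fun \<kappa> D) / h)) \<longlongrightarrow> - (- c_fun \<kappa> D)) (at_right 0)"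
    by (intro tendsto_minus) (auto simp: DERIV_def intro: tendsto_mono[OF at_le])
  then have "((\<lambda>h. - ((s_fun \<kappa> (D - h) - s_fun \<kappa> D) / h) / (s_fun \<kappa> h / h)) \<longlongrightarrow> c_fun \<kappa> D / 1)
    (at_right 0)"
    by (intro tendsto_divide s_fun_tendsto_at_right_0) auto
  moreover have "eventually (\<lambda>h. - ((s_fun \<kappa> (D - h) - s_fun \<kappa> D) / h) / (s_fun \<kappa> h / h)
      = (s_fun \<kappa> D - s_fun \<kappa> (D - h)) / s_fun \<kappa> h) (at_right 0)"
    using eventually_at_right_less[of 0]
  proof eventually_elim
    case (elim h)
    have eq: "- ((s_fun \<kappa> (D - h) - s_fun \<kappa> D) / h) = (s_fun \<kappa> D - s_fun \<kappa> (D - h)) / h"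
      by (metis minus_diff_eq minus_divide_left)
    show ?case unfolding eq using elim by simp
  qed
  ultimately show ?thesis by (simp add: tendsto_cong)
qed

section \<open>From convexity along a geodesic to a bound by the descending slope\<close>

lemma descending_slope_nonneg: "0 \<le> descending_slope Y \<delta> f y"
  by (simp add: descending_slope_def)

lemma sqrt_ereal_power2: "0 \<le> a \<Longrightarrow> sqrt_ereal (a\<^sup>2) = a"
  by (cases a) (auto simp: sqrt_ereal_def power2_eq_square)

text \<open>Points of a nonconstant minimal geodesic approach its starting point without meeting it, so the
  limsup that defines the slope controls the difference quotients along the geodesic. The geodesic is
  parametrised by its arc length \<open>h\<close>.\<close>

lemma descending_slope_along:
  assumes \<gamma>: "minimal_geodesic Y \<delta> y0 y1 \<gamma>" and D: "0 < \<delta> y0 y1"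
    and r: "descending_slope Y \<delta> f y0 < ereal r"
  shows "eventually (\<lambda>h. (f y0 - f (\<gamma> (h / \<delta> y0 y1))) / ereal h < ereal r) (at_right 0)"
proof -
  define D where "D = \<delta> y0 y1"
  have zero: "(0::real) \<in> {0..1}" by simp
  have g: "\<gamma> (h / D) \<in> Y" "\<gamma> (h / D) \<noteq> y0" "\<delta> y0 (\<gamma> (h / D)) = h" if "0 < h" "h < D" for h
  proof -
    have t: "h / D \<in> {0..1}" using that by auto
    show in_Y: "\<gamma> (h / D) \<in> Y" using \<gamma> t unfolding minimal_geodesic_def by blast
    have "\<delta> (\<gamma> 0) (\<gamma> s) = \<bar>0 - s\<bar> * D" if "s \<in> {0..1}" for s
      using \<gamma> that zero unfolding minimal_geodesic_def D_def by metis
    moreover have "\<gamma> 0 = y0" using \<gamma> unfolding minimal_geodesic_def by blast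
    ultimately have dist: "\<delta> y0 (\<gamma> s) = \<bar>0 - s\<bar> * D" if "s \<in> {0..1}" for s
      using that by metis
    show dist_h: "\<delta> y0 (\<gamma> (h / D)) = h" using dist[OF t] that by simp
    have "\<delta> y0 y0 = 0" using dist[OF zero] \<open>\<gamma> 0 = y0\<close> by simp
    with dist_h that show "\<gamma> (h / D) \<noteq> y0" by auto
  qed
  have ev: "eventually (\<lambda>h. 0 < h \<and> h < D) (at_right 0)"
    using D by (auto simp: D_def eventually_at_right_field)
  have lim: "filterlim (\<lambda>h. \<gamma> (h / D)) (punctured_nhds Y \<delta> y0) (at_right 0)"
    unfolding punctured_nhds_def filterlim_INF filterlim_principal
  proof safe
    fix e :: real assume "0 < e"
    then have "eventually (\<lambda>h. h < e) (at_right 0)"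
      by (auto simp: eventually_at_right_field)
    with ev show "eventually (\<lambda>h. \<gamma> (h / D) \<in> {z \<in> Y. z \<noteq> y0 \<and> \<delta> y0 z < e}) (at_right 0)"
      by eventually_elim (use g in auto)
  qed
  have "Limsup (punctured_nhds Y \<delta> y0) (\<lambda>z. (f y0 - f z) / ereal (\<delta> y0 z)) < ereal r"
    using r by (simp add: descending_slope_def)
  then have "eventually (\<lambda>z. (f y0 - f z) / ereal (\<delta> y0 z) < ereal r) (punctured_nhds Y \<delta> y0)"
    by (rule Limsup_lessD)
  then have "eventually (\<lambda>h. (f y0 - f (\<gamma> (h / D))) / ereal (\<delta> y0 (\<gamma> (h / D))) < ereal r)
      (at_right 0)"
    using lim by (rule eventually_compose_filterlim)
  with ev show ?thesis unfolding D_def[symmetric]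
    by eventually_elim (use g in auto)
qed

text \<open>Here all quantities are finite and the distance \<open>d\<close> lies strictly below the critical
  one. Write \<open>e\<close> for the function \<open>expN N \<circ> f\<close> and \<open>y\<close> for the point of the geodesic at distance \<open>h\<close>
  from \<open>y0\<close>. Convexity bounds \<open>e y / e y0\<close> from above by a combination of \<open>1\<close> and
  \<open>q = e y1 / e y0\<close>, while the tangent line of \<open>exp\<close> at \<open>0\<close> bounds it from below by
  \<open>1 + (f y0 - f y) / N\<close>. Since \<open>N < 0\<close>, an upper bound \<open>r h\<close> for \<open>f y0 - f y\<close> makes this lower bound
  \<open>1 + r h / N\<close>. Solving for \<open>q\<close> and letting \<open>h\<close> tend to \<open>0\<close> gives the claim.\<close>

lemma KN_convex_slope_real:
  fixes f :: "'y \<Rightarrow> ereal" and K N a0 a1 r :: real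
  assumes conv: "KN_convex K N Y \<delta> f" and N: "N < 0"
    and Y: "y0 \<in> Y" "y1 \<in> Y"
    and f: "f y0 = ereal a0" "f y1 = ereal a1"
    and fin: "\<And>y. y \<in> Y \<Longrightarrow> f y \<noteq> -\<infinity>"
    and D: "0 < \<delta> y0 y1" "K < 0 \<Longrightarrow> \<delta> y0 y1 < pi * sqrt (N / K)"
    and r: "descending_slope Y \<delta> f y0 < ereal r"
  shows "c_fun (K / N) (\<delta> y0 y1) + s_fun (K / N) (\<delta> y0 y1) / N * r \<le> exp (- (a1 - a0) / N)"
proof -
  define d where "d = \<delta> y0 y1"
  define \<kappa> where "\<kappa> = K / N"
  obtain \<gamma> where \<gamma>: "minimal_geodesic Y \<delta> y0 y1 \<gamma>"
    and le: "\<And>t. t \<in> {0..1} \<Longrightarrow> expN N (f (\<gamma> t))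
          \<le> ereal (\<sigma>_coeff \<kappa> (1 - t) d) * expN N (f y0) + ereal (\<sigma>_coeff \<kappa> t d) * expN N (f y1)"
    using conv[unfolded KN_convex_def, rule_format, OF Y _ _ D(2)] f
    unfolding d_def \<kappa>_def by auto
  have d: "0 < d" using D by (simp add: d_def)
  have s: "0 < s_fun \<kappa> h" if "0 < h" "h \<le> d" for h
    unfolding \<kappa>_def using that D N by (intro s_fun_pos_below_critical_distance) (auto simp: d_def)
  define q where "q = exp (- (a1 - a0) / N)"
  have ev: "eventually (\<lambda>h. 0 < h \<and> h < d) (at_right 0)"
    using d by (auto simp: eventually_at_right_field)
  have "eventually (\<lambda>h. (s_fun \<kappa> d - s_fun \<kappa> (d - h)) / s_fun \<kappa> h
      + s_fun \<kappa> d / N * r / (s_fun \<kappa> h / h) \<le> q) (at_right 0)"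
    using ev descending_slope_along[OF \<gamma> D(1) r]
  proof eventually_elim
    case (elim h)
    define t where "t = h / d"
    have t: "t \<in> {0..1}" "t * d = h" "(1 - t) * d = d - h"
      using elim d by (auto simp: t_def field_simps)
    have sh: "0 < s_fun \<kappa> h" "0 < s_fun \<kappa> d" using elim d s by auto
    have \<sigma>: "\<sigma>_coeff \<kappa> (1 - t) d = s_fun \<kappa> (d - h) / s_fun \<kappa> d" "\<sigma>_coeff \<kappa> t d = s_fun \<kappa> h / s_fun \<kappa> d"
      unfolding \<sigma>_coeff_def t(2,3) using d by simp_all
    have bound: "expN N (f (\<gamma> t)) \<le> ereal (s_fun \<kappa> (d - h) / s_fun \<kappa> d * exp (- a0 / N)
        + s_fun \<kappa> h / s_fun \<kappa> d * exp (- a1 / N))"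
      using le[OF t(1)] by (simp add: \<sigma> f expN_def)
    have "\<gamma> t \<in> Y" using \<gamma> t(1) unfolding minimal_geodesic_def by blast
    then have "f (\<gamma> t) \<noteq> -\<infinity>" by (rule fin)
    moreover from bound have "f (\<gamma> t) \<noteq> \<infinity>"
      by (auto simp: expN_def)
    ultimately obtain a where a: "f (\<gamma> t) = ereal a"
      by (cases "f (\<gamma> t)") simp_all
    have *: "exp (- a / N) \<le> s_fun \<kappa> (d - h) / s_fun \<kappa> d * exp (- a0 / N)
        + s_fun \<kappa> h / s_fun \<kappa> d * exp (- a1 / N)"
      using bound unfolding a by (simp add: expN_def)
    \<comment> \<open>The slope enters here: \<open>\<gamma> t\<close> is at distance \<open>h\<close> from \<open>y0\<close>.\<close>
    have ar: "(a0 - a) / h < r"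
      using elim a f(1) unfolding t_def d_def by simp
    have "1 + (a0 - a) / N \<le> exp ((a0 - a) / N)" by (rule exp_ge_add_one_self)
    also have "\<dots> = exp (- a / N) / exp (- a0 / N)"
      by (simp add: exp_diff[symmetric] diff_divide_distrib)
    also have "\<dots> \<le> (s_fun \<kappa> (d - h) / s_fun \<kappa> d * exp (- a0 / N)
        + s_fun \<kappa> h / s_fun \<kappa> d * exp (- a1 / N)) / exp (- a0 / N)"
      using * by (intro divide_right_mono) auto
    also have "exp (- a1 / N) = q * exp (- a0 / N)"
      by (simp add: q_def diff_divide_distrib flip: exp_add)
    also have "(s_fun \<kappa> (d - h) / s_fun \<kappa> d * exp (- a0 / N)
        + s_fun \<kappa> h / s_fun \<kappa> d * (q * exp (- a0 / N))) / exp (- a0 / N)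
      = s_fun \<kappa> (d - h) / s_fun \<kappa> d + s_fun \<kappa> h / s_fun \<kappa> d * q"
      by (simp add: add_divide_distrib)
    finally have tangent: "1 + (a0 - a) / N \<le> s_fun \<kappa> (d - h) / s_fun \<kappa> d + s_fun \<kappa> h / s_fun \<kappa> d * q" .
    have "a0 - a \<le> r * h" using ar elim by (simp add: pos_divide_less_eq)
    then have "r * h / N \<le> (a0 - a) / N" using N by (intro divide_right_mono_neg) auto
    with tangent have "1 + r * h / N \<le> s_fun \<kappa> (d - h) / s_fun \<kappa> d + s_fun \<kappa> h / s_fun \<kappa> d * q"
      by linarith
    then have "s_fun \<kappa> d / s_fun \<kappa> h * (1 + r * h / N)
        \<le> s_fun \<kappa> d / s_fun \<kappa> h * (s_fun \<kappa> (d - h) / s_fun \<kappa> d + s_fun \<kappa> h / s_fun \<kappa> d * q)"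
      using sh by (intro mult_left_mono) auto
    also have "\<dots> = s_fun \<kappa> (d - h) / s_fun \<kappa> h + q"
      using sh by (simp add: distrib_left)
    finally have "s_fun \<kappa> d / s_fun \<kappa> h * (1 + r * h / N) - s_fun \<kappa> (d - h) / s_fun \<kappa> h \<le> q"
      by (simp only: diff_le_eq add.commute)
    moreover have "s_fun \<kappa> d / s_fun \<kappa> h * (1 + r * h / N)
        = s_fun \<kappa> d / s_fun \<kappa> h + s_fun \<kappa> d / N * r / (s_fun \<kappa> h / h)"
      by (simp add: distrib_left add_divide_distrib mult_ac)
    ultimately show ?case by (simp only: diff_divide_distrib algebra_simps)
  qed
  moreover have "((\<lambda>h. (s_fun \<kappa> d - s_fun \<kappa> (d - h)) / s_fun \<kappa> h
      + s_fun \<kappa> d / N * r / (s_fun \<kappa> h / h)) \<longlongrightarrow> c_fun \<kappa> d + s_fun \<kappa> d / N * r / 1) (at_right 0)"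
    by (intro tendsto_intros s_fun_difference_quotient_tendsto s_fun_tendsto_at_right_0) auto
  ultimately have "c_fun \<kappa> d + s_fun \<kappa> d / N * r / 1 \<le> q"
    by (intro tendsto_upperbound) auto
  then show ?thesis by (simp add: q_def d_def \<kappa>_def)
qed

text \<open>The extended-real form, on an arbitrary space. Besides the finite case there remain the
  degenerate ones: if \<open>f y1 = \<infinity>\<close>, the right-hand side is infinite; if the slope is infinite and
  \<open>s_fun\<close> positive, the left-hand side is \<open>-\<infinity>\<close>; at distance zero both points agree and the inequality
  reads \<open>1 \<le> 1\<close>; at the critical distance convexity asserts nothing, but the left-hand side is \<open>-1\<close>.\<close>

lemma KN_convex_slope_inequality:
  fixes f :: "'y \<Rightarrow> ereal" and K N :: real
  assumes conv: "KN_convex K N Y \<delta> f" and N: "N < 0"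
    and Y: "y0 \<in> Y" "y1 \<in> Y"
    and f0: "f y0 < \<infinity>"
    and fin: "\<And>y. y \<in> Y \<Longrightarrow> f y \<noteq> -\<infinity>"
    and nonneg: "0 \<le> \<delta> y0 y1"
    and eq: "\<delta> y0 y1 = 0 \<Longrightarrow> y0 = y1"
    and diam: "K < 0 \<Longrightarrow> \<delta> y0 y1 \<le> pi * sqrt (N / K)"
  shows "ereal (c_fun (K / N) (\<delta> y0 y1))
      + ereal (s_fun (K / N) (\<delta> y0 y1) / N) * descending_slope Y \<delta> f y0
    \<le> expN N (f y1) / expN N (f y0)"
proof -
  define d \<kappa> S where "d = \<delta> y0 y1" and "\<kappa> = K / N" and "S = descending_slope Y \<delta> f y0"
  obtain a0 where a0: "f y0 = ereal a0" using f0 fin[OF Y(1)] by (cases "f y0") auto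
  have S: "0 \<le> S" by (simp add: S_def descending_slope_nonneg)
  have "ereal (c_fun \<kappa> d) + ereal (s_fun \<kappa> d / N) * S \<le> expN N (f y1) / expN N (f y0)"
  proof (cases "f y1")
    case PInf
    then show ?thesis by (simp add: a0 expN_def divide_ereal_def)
  next
    case MInf
    then show ?thesis using fin[OF Y(2)] by simp
  next
    case (real a1)
    have quot: "expN N (f y1) / expN N (f y0) = ereal (exp (- (a1 - a0) / N))"
      by (simp add: real a0 expN_def diff_divide_distrib flip: exp_diff)
    consider (zero) "d = 0" | (conj) "0 < d" "K < 0" "d = pi * sqrt (N / K)"
      | (int) "0 < d" "K < 0 \<Longrightarrow> d < pi * sqrt (N / K)"
      using nonneg diam unfolding d_def by fastforce
    then show ?thesis
    proof cases
      case zero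
      then have "y0 = y1" using eq by (simp add: d_def)
      then have "a1 = a0" using a0 real by simp
      then show ?thesis unfolding quot using zero by (simp add: zero_ereal_def[symmetric])
    next
      case conj
      then have "c_fun \<kappa> d = -1" "s_fun \<kappa> d = 0"
        unfolding \<kappa>_def using N by (simp_all only: comparison_functions_at_critical_distance)
      then have "ereal (c_fun \<kappa> d) + ereal (s_fun \<kappa> d / N) * S = ereal (-1)"
        by (simp add: zero_ereal_def[symmetric])
      also have "\<dots> \<le> ereal (exp (- (a1 - a0) / N))"
        using exp_gt_zero[of "- (a1 - a0) / N"] by (simp del: exp_gt_zero)
      finally show ?thesis by (simp only: quot)
    next
      case int
      show ?thesis
      proof (cases S)
        case (real s)
        have *: "c_fun \<kappa> d + s_fun \<kappa> d / N * r \<le> exp (- (a1 - a0) / N)" if "s < r" for r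
          unfolding \<kappa>_def d_def
          using that real int \<open>f y1 = ereal a1\<close>
          by (intro KN_convex_slope_real[OF conv N Y a0 _ fin]) (auto simp: S_def d_def)
        \<comment> \<open>The bound holds for every \<open>r > s\<close>; it extends to \<open>r = s\<close> by continuity.\<close>
        have "((\<lambda>r. c_fun \<kappa> d + s_fun \<kappa> d / N * r) \<longlongrightarrow> c_fun \<kappa> d + s_fun \<kappa> d / N * s) (at_right s)"
          by (intro tendsto_intros)
        moreover have "eventually (\<lambda>r. c_fun \<kappa> d + s_fun \<kappa> d / N * r \<le> exp (- (a1 - a0) / N)) (at_right s)"
          using eventually_at_right_less[of s] by eventually_elim (rule *)
        ultimately have "c_fun \<kappa> d + s_fun \<kappa> d / N * s \<le> exp (- (a1 - a0) / N)"
          by (intro tendsto_upperbound) auto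
        then show ?thesis by (simp add: real quot)
      next
        case PInf
        have "0 < s_fun \<kappa> d"
          unfolding \<kappa>_def using N int by (rule s_fun_pos_below_critical_distance)
        then have "s_fun \<kappa> d / N < 0" using N by (simp add: divide_pos_neg)
        moreover have "ereal x * \<infinity> = -\<infinity>" if "x < 0" for x using that by simp
        ultimately show ?thesis unfolding PInf by (simp only: plus_ereal.simps ereal_less_eq)
      next
        case MInf
        with S show ?thesis by simp
      qed
    qed
  qed
  then show ?thesis by (simp add: d_def \<kappa>_def S_def)
qed

section \<open>The Wasserstein distance separates points\<close>

lemma
  fixes \<mu> :: "'a::{complete_space, second_countable_topology} measure"
  assumes "\<mu> \<in> P2"
  shows P2_prob_space: "prob_space \<mu>" and P2_sets: "sets \<mu> = sets borel"
  using assms by (auto simp: P2_def)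

lemma dist_square_le_ennreal:
  "ennreal ((dist x y)\<^sup>2) \<le> 2 * ennreal ((dist z x)\<^sup>2) + 2 * ennreal ((dist z y)\<^sup>2)"
proof -
  have "dist x y \<le> dist z x + dist z y" by (metis dist_triangle dist_commute)
  then have "(dist x y)\<^sup>2 \<le> (dist z x + dist z y)\<^sup>2" by (intro power_mono) auto
  also have "\<dots> \<le> 2 * (dist z x)\<^sup>2 + 2 * (dist z y)\<^sup>2"
    using sum_squares_bound[of "dist z x" "dist z y"] by (simp add: power2_sum)
  finally have "ennreal ((dist x y)\<^sup>2) \<le> ennreal (2 * (dist z x)\<^sup>2 + 2 * (dist z y)\<^sup>2)"
    by (rule ennreal_leI)
  then show ?thesis by (simp add: ennreal_mult)
qed

lemma P2_second_moment:
  fixes \<mu> :: "'a::{complete_space, second_countable_topology} measure"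
  assumes "\<mu> \<in> P2"
  shows "(\<integral>\<^sup>+ y. ennreal ((dist x y)\<^sup>2) \<partial>\<mu>) < \<infinity>"
proof -
  interpret prob_space \<mu> using assms by (rule P2_prob_space)
  note [measurable_cong] = P2_sets[OF assms]
  obtain z where z: "(\<integral>\<^sup>+ y. ennreal ((dist z y)\<^sup>2) \<partial>\<mu>) < \<infinity>"
    using assms by (auto simp: P2_def)
  have "(\<integral>\<^sup>+ y. ennreal ((dist x y)\<^sup>2) \<partial>\<mu>)
      \<le> (\<integral>\<^sup>+ y. 2 * ennreal ((dist z x)\<^sup>2) + 2 * ennreal ((dist z y)\<^sup>2) \<partial>\<mu>)"
    by (intro nn_integral_mono dist_square_le_ennreal)
  also have "\<dots> = 2 * ennreal ((dist z x)\<^sup>2) + 2 * (\<integral>\<^sup>+ y. ennreal ((dist z y)\<^sup>2) \<partial>\<mu>)"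
    by (subst nn_integral_add) (auto simp: nn_integral_cmult emeasure_space_1)
  also have "\<dots> < \<infinity>" using z by (simp add: ennreal_mult_less_top)
  finally show ?thesis .
qed

lemma pair_measure_in_couplings:
  fixes \<mu> \<nu> :: "'a::{complete_space, second_countable_topology} measure"
  assumes "\<mu> \<in> P2" "\<nu> \<in> P2"
  shows "\<mu> \<Otimes>\<^sub>M \<nu> \<in> couplings \<mu> \<nu>"
proof -
  interpret \<mu>: prob_space \<mu> using assms(1) by (rule P2_prob_space)
  interpret \<nu>: prob_space \<nu> using assms(2) by (rule P2_prob_space)
  interpret pair_sigma_finite \<mu> \<nu> ..
  note s = P2_sets[OF assms(1)] P2_sets[OF assms(2)]
  have fst: "distr (\<mu> \<Otimes>\<^sub>M \<nu>) borel fst = distr (\<mu> \<Otimes>\<^sub>M \<nu>) \<mu> fst"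
    by (rule distr_cong) (auto simp: s)
  have "distr (\<mu> \<Otimes>\<^sub>M \<nu>) borel snd = distr (distr (\<nu> \<Otimes>\<^sub>M \<mu>) (\<mu> \<Otimes>\<^sub>M \<nu>) (\<lambda>(x, y). (y, x))) \<nu> snd"
    by (subst distr_pair_swap[symmetric]) (rule distr_cong, auto simp: s)
  also have "\<dots> = distr (\<nu> \<Otimes>\<^sub>M \<mu>) \<nu> fst"
    by (subst distr_distr) (auto simp: comp_def case_prod_beta)
  finally show ?thesis using fst
    by (auto simp: couplings_def \<mu>.distr_pair_fst \<nu>.distr_pair_fst s intro!: sets_pair_measure_cong)
qed

lemma W2_nonneg: "0 \<le> W2 \<mu> \<nu>"
  by (simp add: W2_def)

lemma transport_cost_finite:
  fixes \<mu> \<nu> :: "'a::{complete_space, second_countable_topology} measure"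
  assumes "\<mu> \<in> P2" "\<nu> \<in> P2" and \<pi>: "\<pi> \<in> couplings \<mu> \<nu>"
  shows "(\<integral>\<^sup>+ p. ennreal ((dist (fst p) (snd p))\<^sup>2) \<partial>\<pi>) < \<infinity>"
proof -
  note [measurable_cong] = \<pi>[unfolded couplings_def, simplified, THEN conjunct1]
  have m: "\<mu> = distr \<pi> borel fst" "\<nu> = distr \<pi> borel snd"
    using \<pi> by (auto simp: couplings_def)
  fix z :: 'a
  have "(\<integral>\<^sup>+ p. ennreal ((dist (fst p) (snd p))\<^sup>2) \<partial>\<pi>)
      \<le> (\<integral>\<^sup>+ p. 2 * ennreal ((dist z (fst p))\<^sup>2) + 2 * ennreal ((dist z (snd p))\<^sup>2) \<partial>\<pi>)"
    by (intro nn_integral_mono dist_square_le_ennreal)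
  also have "\<dots> = 2 * (\<integral>\<^sup>+ p. ennreal ((dist z (fst p))\<^sup>2) \<partial>\<pi>)
      + 2 * (\<integral>\<^sup>+ p. ennreal ((dist z (snd p))\<^sup>2) \<partial>\<pi>)"
    by (subst nn_integral_add) (auto simp: nn_integral_cmult)
  also have "\<dots> = 2 * (\<integral>\<^sup>+ y. ennreal ((dist z y)\<^sup>2) \<partial>\<mu>) + 2 * (\<integral>\<^sup>+ y. ennreal ((dist z y)\<^sup>2) \<partial>\<nu>)"
    unfolding m by (simp add: nn_integral_distr)
  also have "\<dots> < \<infinity>"
    using P2_second_moment[OF assms(1), of z] P2_second_moment[OF assms(2), of z]
    by (simp add: ennreal_mult_less_top)
  finally show ?thesis .
qed

text \<open>A vanishing \<open>W2\<close> could also come from an infinite transport cost, which is converted to the real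
  number \<open>0\<close>. The product coupling has finite cost, so the infimum is a genuine zero.\<close>

lemma W2_eq_0_obtains_coupling:
  fixes \<mu> \<nu> :: "'a::{complete_space, second_countable_topology} measure"
  assumes P2: "\<mu> \<in> P2" "\<nu> \<in> P2" and W2: "W2 \<mu> \<nu> = 0" and c: "0 < c"
  obtains \<pi> where "\<pi> \<in> couplings \<mu> \<nu>" "(\<integral>\<^sup>+ p. ennreal ((dist (fst p) (snd p))\<^sup>2) \<partial>\<pi>) < c"
proof -
  let ?I = "\<Sqinter>\<pi>\<in>couplings \<mu> \<nu>. \<integral>\<^sup>+ p. ennreal ((dist (fst p) (snd p))\<^sup>2) \<partial>\<pi>"
  have "?I \<le> (\<integral>\<^sup>+ p. ennreal ((dist (fst p) (snd p))\<^sup>2) \<partial>(\<mu> \<Otimes>\<^sub>M \<nu>))"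
    by (intro INF_lower pair_measure_in_couplings P2)
  also have "\<dots> < \<infinity>"
    by (intro transport_cost_finite[OF P2] pair_measure_in_couplings P2)
  finally have "?I = 0" using W2 by (auto simp: W2_def enn2real_eq_0_iff)
  with c have "?I < c" by simp
  then show ?thesis using that by (auto simp: INF_less_iff)
qed

text \<open>If \<open>X\<close> lies in \<open>C\<close>, then \<open>Y\<close> lies in the \<open>e\<close>-thickening of \<open>C\<close> unless \<open>X\<close> and \<open>Y\<close> are
  at distance at least \<open>e\<close>, an event whose mass Markov's inequality bounds. Random variables \<open>X\<close> and \<open>Y\<close>
  instead of the two projections of a coupling allow the roles of the marginals to be exchanged.\<close>

lemma emeasure_distr_closed_le:
  fixes X Y :: "'b \<Rightarrow> 'a::{complete_space, second_countable_topology}"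
  assumes [measurable]: "X \<in> borel_measurable M" "Y \<in> borel_measurable M"
    and C: "closed C" and e: "0 < e"
  shows "emeasure (distr M borel X) C
    \<le> emeasure (distr M borel Y) {y. infdist y C \<le> e}
      + ennreal (1 / e\<^sup>2) * (\<integral>\<^sup>+ p. ennreal ((dist (X p) (Y p))\<^sup>2) \<partial>M)"
proof -
  have [measurable]: "C \<in> sets borel" using C by simp
  have "closed {y. infdist y C \<le> e}"
    by (intro closed_Collect_le continuous_intros)
  then have [measurable]: "{y. infdist y C \<le> e} \<in> sets borel" by simp
  have [measurable]: "(\<lambda>y. infdist y C) \<in> borel_measurable borel"
    by (intro borel_measurable_continuous_onI continuous_intros)
  have far: "1 \<le> ennreal (1 / e\<^sup>2) * ennreal ((dist (X p) (Y p))\<^sup>2)"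
    if "X p \<in> C" "\<not> infdist (Y p) C \<le> e" for p
  proof -
    have "e \<le> dist (X p) (Y p)"
      using that infdist_le[of "X p" C "Y p"] by (simp add: dist_commute)
    then have "e\<^sup>2 \<le> (dist (X p) (Y p))\<^sup>2" using e by (intro power_mono) auto
    then have "ennreal 1 \<le> ennreal (1 / e\<^sup>2 * (dist (X p) (Y p))\<^sup>2)"
      using e by (intro ennreal_leI) (simp add: field_simps)
    also have "\<dots> = ennreal (1 / e\<^sup>2) * ennreal ((dist (X p) (Y p))\<^sup>2)"
      by (intro ennreal_mult) auto
    finally show ?thesis by simp
  qed
  have "emeasure (distr M borel X) C = emeasure M {p \<in> space M. X p \<in> C}"
    by (simp add: emeasure_distr vimage_def Int_def conj_commute)
  also have "\<dots> \<le> emeasure M ({p \<in> space M. infdist (Y p) C \<le> e}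
      \<union> {p \<in> space M. 1 \<le> ennreal (1 / e\<^sup>2) * ennreal ((dist (X p) (Y p))\<^sup>2)})"
    using far by (intro emeasure_mono) auto
  also have "\<dots> \<le> emeasure M {p \<in> space M. infdist (Y p) C \<le> e}
      + emeasure M {p \<in> space M. 1 \<le> ennreal (1 / e\<^sup>2) * ennreal ((dist (X p) (Y p))\<^sup>2)}"
    by (intro emeasure_subadditive) auto
  also have "emeasure M {p \<in> space M. infdist (Y p) C \<le> e}
      = emeasure (distr M borel Y) {y. infdist y C \<le> e}"
    by (simp add: emeasure_distr vimage_def Int_def conj_commute)
  also have "emeasure M {p \<in> space M. 1 \<le> ennreal (1 / e\<^sup>2) * ennreal ((dist (X p) (Y p))\<^sup>2)}
      \<le> ennreal (1 / e\<^sup>2) * (\<integral>\<^sup>+ p. ennreal ((dist (X p) (Y p))\<^sup>2) * indicator (space M) p \<partial>M)"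
    by (intro nn_integral_Markov_inequality) auto
  also have "(\<integral>\<^sup>+ p. ennreal ((dist (X p) (Y p))\<^sup>2) * indicator (space M) p \<partial>M)
      = (\<integral>\<^sup>+ p. ennreal ((dist (X p) (Y p))\<^sup>2) \<partial>M)"
    by (intro nn_integral_cong) auto
  finally show ?thesis by (simp add: add_left_mono)
qed

text \<open>A nonempty closed set is the decreasing intersection of its thickenings. The empty set is treated
  apart: since \<open>infdist y {} = 0\<close>, its thickenings are the whole space.\<close>

lemma emeasure_closed_le_of_thickenings:
  fixes \<mu> \<nu> :: "'a::{complete_space, second_countable_topology} measure"
  assumes \<nu>: "finite_measure \<nu>" "sets \<nu> = sets borel" and C: "closed C"
    and le: "\<And>e. 0 < e \<Longrightarrow> emeasure \<mu> C \<le> emeasure \<nu> {y. infdist y C \<le> e}"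
  shows "emeasure \<mu> C \<le> emeasure \<nu> C"
proof (cases "C = {}")
  case False
  let ?A = "\<lambda>n. {y. infdist y C \<le> 1 / real (Suc n)}"
  interpret finite_measure \<nu> by fact
  have "?A n \<subseteq> ?A k" if "k \<le> n" for k n
  proof -
    from that have "1 / real (Suc n) \<le> 1 / real (Suc k)" by (intro frac_le) auto
    then show ?thesis by auto
  qed
  then have dec: "decseq ?A" by (auto simp: decseq_def)
  have "closed (?A n)" for n
    by (intro closed_Collect_le continuous_intros)
  then have "(\<lambda>n. emeasure \<nu> (?A n)) \<longlonglongrightarrow> emeasure \<nu> (\<Inter>n. ?A n)"
    using \<nu> dec by (intro Lim_emeasure_decseq) (auto simp del: of_nat_Suc)
  moreover have "(\<Inter>n. ?A n) = C"
  proof safe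
    fix y assume "y \<in> (\<Inter>n. ?A n)"
    then have "infdist y C \<le> 1 / real (Suc n)" for n by auto
    then have "infdist y C \<le> 0"
      using LIMSEQ_inverse_real_of_nat by (intro tendsto_lowerbound) (auto simp: inverse_eq_divide)
    then show "y \<in> C"
      using C False infdist_nonneg[of y C] by (auto simp: in_closed_iff_infdist_zero)
  qed simp_all
  ultimately have "(\<lambda>n. emeasure \<nu> (?A n)) \<longlonglongrightarrow> emeasure \<nu> C" by (simp only:)
  moreover have "emeasure \<mu> C \<le> emeasure \<nu> (?A n)" for n by (rule le) simp
  ultimately show ?thesis using LIMSEQ_le_const by blast
qed simp

lemma W2_eq_0_imp_emeasure_closed_le:
  fixes \<mu> \<nu> :: "'a::{complete_space, second_countable_topology} measure"
  assumes P2: "\<mu> \<in> P2" "\<nu> \<in> P2" and W2: "W2 \<mu> \<nu> = 0" and C: "closed C"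
  shows "emeasure \<mu> C \<le> emeasure \<nu> C" "emeasure \<nu> C \<le> emeasure \<mu> C"
proof -
  have *: "emeasure \<mu> C \<le> emeasure \<nu> {y. infdist y C \<le> e} + ennreal d"
    "emeasure \<nu> C \<le> emeasure \<mu> {y. infdist y C \<le> e} + ennreal d" if "0 < e" "0 < d" for e d :: real
  proof -
    \<comment> \<open>A cost below \<open>e\<^sup>2 d\<close> makes the error term of Markov's inequality at most \<open>d\<close>.\<close>
    have "0 < ennreal (e\<^sup>2 * d)" using that by simp
    then obtain \<pi> where \<pi>: "\<pi> \<in> couplings \<mu> \<nu>"
      and cost: "(\<integral>\<^sup>+ p. ennreal ((dist (fst p) (snd p))\<^sup>2) \<partial>\<pi>) < ennreal (e\<^sup>2 * d)"
      using W2_eq_0_obtains_coupling[OF P2 W2] by blast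
    have [measurable_cong]: "sets \<pi> = sets (borel \<Otimes>\<^sub>M borel)"
      and m: "distr \<pi> borel fst = \<mu>" "distr \<pi> borel snd = \<nu>"
      using \<pi> by (auto simp: couplings_def)
    have fs [measurable]: "fst \<in> borel_measurable \<pi>" "snd \<in> borel_measurable \<pi>" by measurable
    have "ennreal (1 / e\<^sup>2) * (\<integral>\<^sup>+ p. ennreal ((dist (fst p) (snd p))\<^sup>2) \<partial>\<pi>)
        \<le> ennreal (1 / e\<^sup>2) * ennreal (e\<^sup>2 * d)"
      using cost by (intro mult_left_mono) auto
    also have "\<dots> = ennreal d"
      using that by (simp add: ennreal_mult'[symmetric])
    finally have small: "ennreal (1 / e\<^sup>2) * (\<integral>\<^sup>+ p. ennreal ((dist (fst p) (snd p))\<^sup>2) \<partial>\<pi>) \<le> ennreal d" .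
    have "emeasure \<mu> C \<le> emeasure \<nu> {y. infdist y C \<le> e}
        + ennreal (1 / e\<^sup>2) * (\<integral>\<^sup>+ p. ennreal ((dist (fst p) (snd p))\<^sup>2) \<partial>\<pi>)"
      using emeasure_distr_closed_le[OF fs C that(1)] unfolding m .
    also have "\<dots> \<le> emeasure \<nu> {y. infdist y C \<le> e} + ennreal d"
      by (intro add_left_mono small)
    finally show "emeasure \<mu> C \<le> emeasure \<nu> {y. infdist y C \<le> e} + ennreal d" .
    have "emeasure \<nu> C \<le> emeasure \<mu> {y. infdist y C \<le> e}
        + ennreal (1 / e\<^sup>2) * (\<integral>\<^sup>+ p. ennreal ((dist (fst p) (snd p))\<^sup>2) \<partial>\<pi>)"
      using emeasure_distr_closed_le[OF fs(2,1) C that(1)]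
      unfolding m by (simp only: dist_commute)
    also have "\<dots> \<le> emeasure \<mu> {y. infdist y C \<le> e} + ennreal d"
      by (intro add_left_mono small)
    finally show "emeasure \<nu> C \<le> emeasure \<mu> {y. infdist y C \<le> e} + ennreal d" .
  qed
  interpret \<mu>: prob_space \<mu> using P2(1) by (rule P2_prob_space)
  interpret \<nu>: prob_space \<nu> using P2(2) by (rule P2_prob_space)
  have thick: "emeasure \<mu> C \<le> emeasure \<nu> {y. infdist y C \<le> e}"
    "emeasure \<nu> C \<le> emeasure \<mu> {y. infdist y C \<le> e}" if "0 < e" for e
    using *[OF that] by (auto intro: ennreal_le_epsilon)
  show "emeasure \<mu> C \<le> emeasure \<nu> C"
    using \<nu>.finite_measure_axioms P2_sets[OF P2(2)] C thick(1)
    by (rule emeasure_closed_le_of_thickenings)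
  show "emeasure \<nu> C \<le> emeasure \<mu> C"
    using \<mu>.finite_measure_axioms P2_sets[OF P2(1)] C thick(2)
    by (rule emeasure_closed_le_of_thickenings)
qed

text \<open>Passing to complements, the measures agree on open sets, which are stable under intersection
  and generate the Borel sets.\<close>

lemma W2_eq_0_imp_eq:
  fixes \<mu> \<nu> :: "'a::{complete_space, second_countable_topology} measure"
  assumes P2: "\<mu> \<in> P2" "\<nu> \<in> P2" and W2: "W2 \<mu> \<nu> = 0"
  shows "\<mu> = \<nu>"
proof (rule measure_eqI_generator_eq[where \<Omega> = UNIV and E = "{S. open S}" and A = "\<lambda>_. UNIV"])
  interpret \<mu>: prob_space \<mu> using P2(1) by (rule P2_prob_space)
  interpret \<nu>: prob_space \<nu> using P2(2) by (rule P2_prob_space)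
  have sp: "space \<mu> = UNIV" "space \<nu> = UNIV"
    using P2[THEN P2_sets] by (auto dest: sets_eq_imp_space_eq)
  fix U :: "'a set" assume "U \<in> {S. open S}"
  then have "closed (- U)" by auto
  then have "emeasure \<mu> (- U) = emeasure \<nu> (- U)"
    using W2_eq_0_imp_emeasure_closed_le[OF P2 W2] by (intro antisym)
  moreover have "- (- U) = UNIV - (- U)" "- U \<in> sets \<mu>" "- U \<in> sets \<nu>"
    using P2[THEN P2_sets] \<open>closed (- U)\<close> by auto
  then have "emeasure \<mu> U = 1 - emeasure \<mu> (- U)" "emeasure \<nu> U = 1 - emeasure \<nu> (- U)"
    using emeasure_compl[of "- U" \<mu>] emeasure_compl[of "- U" \<nu>]
      \<mu>.emeasure_space_1 \<nu>.emeasure_space_1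
    unfolding sp by (simp_all add: Compl_eq_Diff_UNIV[symmetric])
  ultimately show "emeasure \<mu> U = emeasure \<nu> U" by simp
next
  show "Int_stable {S :: 'a set. open S}" by (auto simp: Int_stable_def)
  show "emeasure \<mu> UNIV \<noteq> \<infinity>"
    using P2(1)[THEN P2_prob_space] by (simp add: prob_space_def finite_measure.emeasure_finite)
qed (use P2[THEN P2_sets] in \<open>auto simp: sets_borel\<close>)

section \<open>Lower bound on the entropy\<close>

text \<open>This is \<open>ln x \<le> x - 1\<close> at \<open>x = exp (- a) / r\<close>. With \<open>r\<close> the density and \<open>a\<close> the squared distance
  to a base point, it bounds the negative part of the entropy integrand by a term with finite integral
  against a measure of finite second moment plus a Gaussian.\<close>

lemma minus_mult_ln_le:
  fixes r a :: real
  assumes "0 \<le> r"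
  shows "- (r * ln r) \<le> a * r + exp (- a)"
proof (cases "r = 0")
  case False
  with assms have r: "0 < r" by simp
  have "- a - ln r = ln (exp (- a) / r)" using r by (simp add: ln_div)
  also have "\<dots> \<le> exp (- a) / r - 1" using r by (intro ln_le_minus_one) simp
  finally have "r * (- a - ln r) \<le> r * (exp (- a) / r - 1)" using r by (intro mult_left_mono) auto
  also have "\<dots> \<le> exp (- a)" using r by (simp add: field_simps)
  finally show ?thesis by (simp add: algebra_simps)
qed simp

lemma Ent_not_MInf:
  fixes m :: "'a::{complete_space, second_countable_topology} measure"
  assumes m: "sets m = sets borel"
    and int: "(\<integral>\<^sup>+ y. ennreal (exp (- (dist x y)\<^sup>2)) \<partial>m) < \<infinity>"
    and \<mu>: "\<mu> \<in> P2"
  shows "Ent m \<mu> \<noteq> -\<infinity>"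
proof (cases "density m (RN_deriv m \<mu>) = \<mu>")
  case False
  then show ?thesis by (simp add: Ent_def)
next
  case True
  note [measurable_cong] = m
  define \<rho> where "\<rho> = (\<lambda>y. enn2real (RN_deriv m \<mu> y))"
  have "(\<integral>\<^sup>+ y. ennreal (- (\<rho> y * ln (\<rho> y))) \<partial>m)
      \<le> (\<integral>\<^sup>+ y. RN_deriv m \<mu> y * ennreal ((dist x y)\<^sup>2) + ennreal (exp (- (dist x y)\<^sup>2)) \<partial>m)"
  proof (rule nn_integral_mono)
    fix y
    have "ennreal (- (\<rho> y * ln (\<rho> y))) \<le> ennreal ((dist x y)\<^sup>2 * \<rho> y + exp (- (dist x y)\<^sup>2))"
      by (intro ennreal_leI minus_mult_ln_le) (simp add: \<rho>_def)
    also have "\<dots> = ennreal (\<rho> y) * ennreal ((dist x y)\<^sup>2) + ennreal (exp (- (dist x y)\<^sup>2))"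
      by (simp add: \<rho>_def ennreal_mult mult.commute)
    also have "ennreal (\<rho> y) \<le> RN_deriv m \<mu> y"
      unfolding \<rho>_def by (cases "RN_deriv m \<mu> y") auto
    finally show "ennreal (- (\<rho> y * ln (\<rho> y)))
        \<le> RN_deriv m \<mu> y * ennreal ((dist x y)\<^sup>2) + ennreal (exp (- (dist x y)\<^sup>2))"
      by (simp add: mult_right_mono add_right_mono)
  qed
  also have "\<dots> = (\<integral>\<^sup>+ y. ennreal ((dist x y)\<^sup>2) \<partial>density m (RN_deriv m \<mu>))
      + (\<integral>\<^sup>+ y. ennreal (exp (- (dist x y)\<^sup>2)) \<partial>m)"
    by (subst nn_integral_add) (auto simp: nn_integral_density)
  also have "\<dots> < \<infinity>"
    using P2_second_moment[OF \<mu>, of x] int by (simp add: True)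
  finally have "(\<integral>\<^sup>+ y. ennreal (- (\<rho> y * ln (\<rho> y))) \<partial>m) < \<infinity>" .
  then show ?thesis
    by (auto simp: Ent_def Let_def \<rho>_def minus_ereal_def ereal_plus_eq_MInfty less_top[symmetric]
        ereal_uminus_eq_reorder)
qed

section \<open>The inequality for the entropy\<close>

theorem theorem4p17:
  fixes m :: "'a::{complete_space, second_countable_topology} measure"
    and K N :: real and \<mu>0 \<mu>1 :: "'a measure"
  assumes "sets m = sets borel"
    and "\<exists>x. \<forall>c>0. (\<integral>\<^sup>+ y. ennreal (exp (- c * (dist x y)\<^sup>2)) \<partial>m) < \<infinity>"
    and "N < 0"
    and "CDe K N m"
    and "\<mu>0 \<in> P2" and "\<mu>1 \<in> P2"
    and "Ent m \<mu>0 < \<infinity>"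
    and "K < 0 \<Longrightarrow> W2 \<mu>0 \<mu>1 \<le> pi * sqrt (N / K)"
  shows "E_N N m \<mu>1 / E_N N m \<mu>0
    \<ge> ereal (c_fun (K / N) (W2 \<mu>0 \<mu>1))
      + ereal (s_fun (K / N) (W2 \<mu>0 \<mu>1) / N) * sqrt_ereal (Fisher_information m \<mu>0)"
proof -
  obtain x where x: "\<And>c. c > 0 \<Longrightarrow> (\<integral>\<^sup>+ y. ennreal (exp (- c * (dist x y)\<^sup>2)) \<partial>m) < \<infinity>"
    using assms(2) by blast
  have "(\<integral>\<^sup>+ y. ennreal (exp (- (dist x y)\<^sup>2)) \<partial>m) < \<infinity>"
    using x[of 1] by simp
  then have fin: "Ent m \<mu> \<noteq> -\<infinity>" if "\<mu> \<in> P2" for \<mu>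
    using that by (rule Ent_not_MInf[OF assms(1)])
  have slope: "sqrt_ereal (Fisher_information m \<mu>0) = descending_slope P2 W2 (Ent m) \<mu>0"
    unfolding Fisher_information_def by (intro sqrt_ereal_power2 descending_slope_nonneg)
  show ?thesis
    unfolding E_N_def slope
    using assms(4)[unfolded CDe_def] assms(3,5,6,7) fin W2_nonneg
      W2_eq_0_imp_eq[OF assms(5,6)] assms(8)
    by (rule KN_convex_slope_inequality)
qed

end
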